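(* Let $\mu$ be a locally finite positive Borel measure on $\mathbb{R}^n$. Suppose that for some integer $\kappa>1$ there is a positive constant $C_\kappa$ such that $$|Q|_\mu\le C_\kappa\int_Q|P(x)|^2\,d\mu(x)$$ for all cubes $Q$ in $\mathbb{R}^n$ and all $Q$-normalized polynomials $P$ of degree less than $\kappa$. Then $\mu$ is doubling.
   Context: Cubes have sides parallel to the coordinate axes; $|Q|_\mu=\mu(Q)$, $c_Q$ is the center and $\ell(Q)$ the side length of $Q$, and $\beta Q$ is the concentric dilate of $Q$ by the factor $\beta$. A polynomial $P(y)=\sum_{0\le|\beta|<\kappa}c_\beta y^\beta$ on $\mathbb{R}^n$ of degree less than $\kappa$ is normalized if $\sup_{y\in Q_0}|P(y)|=1$, where $Q_0=\prod_{i=1}^n[-\frac12,\frac12)$. It is $Q$-normalized if $P^Q(y)=P(c_Q+\ell(Q)y)$ is normalized. $\mu$ is doubling if there exist constants $0<\beta,\gamma<1$ such that $|\beta Q|_\mu\ge\gamma|Q|_\mu$ for all cubes $Q$ in $\mathbb{R}^n$. *)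

theory Defs
  imports "HOL-Analysis.Analysis"
begin

definition locally_finite_measure :: "'a::topological_space measure \<Rightarrow> bool" where
  "locally_finite_measure M \<longleftrightarrow> (\<forall>x. \<exists>U. open U \<and> x \<in> U \<and> emeasure M U < \<infinity>)"

(* A cube is given by its centre and side length, so that the concentric dilate of
   "cube c l" by the factor b is "cube c (b * l)".  Cubes are half-open, as Q_0 = cube 0 1 is;
   they are the images c + l Q_0. *)
definition cube :: "real ^ 'n \<Rightarrow> real \<Rightarrow> (real ^ 'n) set" where
  "cube c l = {x. \<forall>i. c $ i - l / 2 \<le> x $ i \<and> x $ i < c $ i + l / 2}"

(* Multi-indices are functions b :: 'n => nat; their order is the sum of all entries. *)
definition polynomial_deg_less :: "nat \<Rightarrow> (real ^ 'n \<Rightarrow> real) \<Rightarrow> bool" where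
  "polynomial_deg_less k P \<longleftrightarrow>
     (\<exists>a. \<forall>y. P y = (\<Sum>b | sum b (UNIV :: 'n set) < k. a b * (\<Prod>i\<in>UNIV. (y $ i) ^ b i)))"

definition normalized_polynomial :: "nat \<Rightarrow> (real ^ 'n \<Rightarrow> real) \<Rightarrow> bool" where
  "normalized_polynomial k P \<longleftrightarrow>
     polynomial_deg_less k P \<and> (SUP y\<in>cube 0 1. \<bar>P y\<bar>) = 1"

definition cube_normalized_polynomial ::
    "real ^ 'n \<Rightarrow> real \<Rightarrow> nat \<Rightarrow> (real ^ 'n \<Rightarrow> real) \<Rightarrow> bool" where
  "cube_normalized_polynomial c l k P \<longleftrightarrow>
     polynomial_deg_less k P \<and> normalized_polynomial k (\<lambda>y. P (c + l *\<^sub>R y))"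

definition doubling_measure :: "(real ^ 'n) measure \<Rightarrow> bool" where
  "doubling_measure M \<longleftrightarrow>
     (\<exists>b g :: real. 0 < b \<and> b < 1 \<and> 0 < g \<and> g < 1 \<and>
        (\<forall>c l. 0 < l \<longrightarrow> emeasure M (cube c (b * l)) \<ge> ennreal g * emeasure M (cube c l)))"

(* The sum in polynomial_deg_less is a finite one, and the supremum in normalized_polynomial
   is that of a nonempty set bounded above. *)

lemma finite_multi_indices: "finite {b :: 'n::finite \<Rightarrow> nat. sum b UNIV < k}"
proof (rule finite_subset)
  have "b i < k" if "sum b UNIV < k" for b :: "'n \<Rightarrow> nat" and i
    using member_le_sum[of i UNIV b] that by simp
  then show "{b :: 'n \<Rightarrow> nat. sum b UNIV < k} \<subseteq> PiE UNIV (\<lambda>_. {..<k})"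
    by (auto simp: PiE_UNIV_domain)
  show "finite (PiE (UNIV :: 'n set) (\<lambda>_. {..<k}))"
    by (intro finite_PiE) auto
qed

lemma cube_nonempty: "0 < l \<Longrightarrow> cube c l \<noteq> {}"
  by (auto simp: cube_def intro!: exI[of _ c])

lemma polynomial_deg_less_bdd_above:
  assumes "polynomial_deg_less k P"
  shows "bdd_above ((\<lambda>y. \<bar>P y\<bar>) ` cube c l)"
proof -
  obtain a where a: "\<And>y. P y = (\<Sum>b | sum b UNIV < k. a b * (\<Prod>i\<in>UNIV. (y $ i) ^ b i))"
    using assms unfolding polynomial_deg_less_def by blast
  let ?K = "cbox (\<chi> i. c $ i - l / 2) (\<chi> i. c $ i + l / 2)"
  have "continuous_on ?K (\<lambda>y. \<bar>P y\<bar>)"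
    unfolding a by (intro continuous_intros)
  then have "bdd_above ((\<lambda>y. \<bar>P y\<bar>) ` ?K)"
    by (intro bounded_imp_bdd_above compact_imp_bounded compact_continuous_image compact_cbox)
  moreover have "cube c l \<subseteq> ?K"
    by (auto simp: cube_def mem_box_cart less_imp_le)
  ultimately show ?thesis
    by (meson bdd_above_mono image_mono)
qed

end

theory Submission imports Defs begin

text \<open>
  Only polynomials of degree one are needed. The affine function that vanishes on one face of a
  cube \<open>K\<close> and equals \<open>1\<close> on the opposite face is \<open>K\<close>-normalized and at most \<open>\<delta>\<close> on the layer of
  relative thickness \<open>\<delta>\<close> along the first face, so for \<open>C \<delta>\<^sup>2 \<le> 1/2\<close> the measure of \<open>K\<close> is at
  most \<open>2 C\<close> times the measure of \<open>K\<close> without the layer. A box whose sides lie between \<open>s\<close> and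
  \<open>2 s\<close> is covered by the \<open>2\<^sup>n\<close> cubes of side \<open>s\<close> sitting in its corners, so cutting a layer off
  one face of such a box costs at most the factor \<open>2\<^sup>n \<cdot> 2 C\<close>. Cutting a layer off each of the
  \<open>2 n\<close> faces of a cube, one after the other, leaves a concentric dilate of it.
\<close>

section \<open>Boxes, cubes and local finiteness\<close>

definition half_open_box :: "real ^ 'n \<Rightarrow> real ^ 'n \<Rightarrow> (real ^ 'n) set" where
  "half_open_box u v = {x. \<forall>i. u $ i \<le> x $ i \<and> x $ i < v $ i}"

text \<open>Cutting one face at a time passes from a cube to its dilate through boxes that are not
  cubes; this identity is used at both ends of that chain.\<close>

lemma cube_eq_half_open_box:
  "cube c l = half_open_box (\<chi> i. c $ i - l / 2) (\<chi> i. c $ i + l / 2)"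
  by (simp add: cube_def half_open_box_def)

lemma half_open_box_borel [measurable]:
  fixes u v :: "real ^ 'n"
  shows "half_open_box u v \<in> sets borel"
proof -
  have "closed {x :: real ^ 'n. \<forall>i. u $ i \<le> x $ i}"
    by (intro closed_Collect_all closed_Collect_le continuous_intros)
  moreover have "{x :: real ^ 'n. \<forall>i. x $ i < v $ i} = (\<Inter>i. {x. x $ i < v $ i})"
    by auto
  then have "open {x :: real ^ 'n. \<forall>i. x $ i < v $ i}"
    by (auto intro!: open_INT open_Collect_less continuous_intros)
  moreover have "half_open_box u v = {x. \<forall>i. u $ i \<le> x $ i} \<inter> {x. \<forall>i. x $ i < v $ i}"
    by (auto simp: half_open_box_def)
  ultimately show ?thesis
    by (simp add: sets.Int)
qed

lemma cube_borel [measurable]: "cube c l \<in> sets borel"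
  by (simp add: cube_eq_half_open_box)

lemma locally_finite_measure_compact:
  assumes "locally_finite_measure M" "sets M = sets borel" "compact K"
  shows "emeasure M K < \<infinity>"
proof -
  obtain U where U: "\<And>x. open (U x)" "\<And>x. x \<in> U x" "\<And>x. emeasure M (U x) < \<infinity>"
    using assms(1) unfolding locally_finite_measure_def by metis
  have "K \<subseteq> (\<Union>x\<in>K. U x)"
    using U(2) by auto
  then obtain D where D: "D \<subseteq> K" "finite D" "K \<subseteq> (\<Union>x\<in>D. U x)"
    using compactE_image[OF assms(3), of K U] U(1) by metis
  have "emeasure M K \<le> emeasure M (\<Union>x\<in>D. U x)"
    using D(3) U(1) assms(2) by (intro emeasure_mono) (auto intro!: borel_open)
  also have "\<dots> \<le> (\<Sum>x\<in>D. emeasure M (U x))"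
    using D(2) U(1) assms(2) by (intro emeasure_subadditive_finite) auto
  also have "\<dots> < \<infinity>"
    using D(2) U(3) by simp
  finally show ?thesis .
qed

section \<open>Affine functions as cube-normalized polynomials\<close>

lemma polynomial_deg_less_affine:
  assumes "1 < k"
  shows "polynomial_deg_less k (\<lambda>x :: real ^ 'n. p + q * x $ i)"
proof -
  \<comment> \<open>\<open>e\<close> is the multi-index of the monomial \<open>y $ i\<close>; the
    coefficients \<open>a\<close> are supported on it and on the zero multi-index.\<close>
  define e :: "'n \<Rightarrow> nat" where "e = (\<lambda>j. if j = i then 1 else 0)"
  define a where "a b = (if b = (\<lambda>_. 0) then p else if b = e then q else 0)" for b
  have e_ne: "e \<noteq> (\<lambda>_. 0)"
    by (auto simp: e_def fun_eq_iff)
  have sum_e: "sum e UNIV = 1"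
    by (simp add: e_def)
  have "p + q * y $ i = (\<Sum>b | sum b UNIV < k. a b * (\<Prod>j\<in>UNIV. (y $ j) ^ b j))"
    for y :: "real ^ 'n"
  proof -
    have "(\<Prod>j\<in>UNIV. (y $ j) ^ e j) = (\<Prod>j\<in>UNIV. if j = i then y $ j else 1)"
      by (intro prod.cong) (auto simp: e_def)
    then have "(\<Prod>j\<in>UNIV. (y $ j) ^ e j) = y $ i"
      by simp
    then have "(\<Sum>b\<in>{\<lambda>_. 0, e}. a b * (\<Prod>j\<in>UNIV. (y $ j) ^ b j)) = p + q * y $ i"
      using e_ne by (simp add: a_def)
    moreover have "(\<Sum>b | sum b UNIV < k. a b * (\<Prod>j\<in>UNIV. (y $ j) ^ b j)) =
        (\<Sum>b\<in>{\<lambda>_. 0, e}. a b * (\<Prod>j\<in>UNIV. (y $ j) ^ b j))"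
      using assms sum_e
      by (intro sum.mono_neutral_right finite_multi_indices) (auto simp: a_def)
    ultimately show ?thesis
      by simp
  qed
  then show ?thesis
    unfolding polynomial_deg_less_def by blast
qed

text \<open>Rescaling to the unit cube turns the function into \<open>1 / 2 + e * y $ i\<close>,
  whose values fill \<open>[0, 1)\<close> for \<open>e = 1\<close> and \<open>(0, 1]\<close> for
  \<open>e = -1\<close>.\<close>

lemma cube_normalized_polynomial_affine:
  fixes c :: "real ^ 'n" and e :: real
  assumes "1 < k" "0 < s" "e = 1 \<or> e = -1"
  shows "cube_normalized_polynomial c s k (\<lambda>x. 1 / 2 + e * (x $ i - c $ i) / s)"
proof -
  have eq: "1 / 2 + e * ((c + s *\<^sub>R y) $ i - c $ i) / s = 1 / 2 + e * y $ i" for y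
    using assms(2) by (simp add: field_simps)
  have "polynomial_deg_less k (\<lambda>x :: real ^ 'n. (1 / 2 - e * c $ i / s) + e / s * x $ i)"
    by (rule polynomial_deg_less_affine[OF assms(1)])
  moreover have "(1 / 2 - e * c $ i / s) + e / s * x $ i = 1 / 2 + e * (x $ i - c $ i) / s"
    for x :: "real ^ 'n"
    by (simp add: right_diff_distrib diff_divide_distrib)
  ultimately have "polynomial_deg_less k (\<lambda>x. 1 / 2 + e * (x $ i - c $ i) / s)"
    by (simp only:)
  moreover have "(SUP y\<in>cube 0 1. \<bar>1 / 2 + e * (y :: real ^ 'n) $ i\<bar>) = 1"
  proof (rule cSup_eq_non_empty)
    show "(\<lambda>y :: real ^ 'n. \<bar>1 / 2 + e * y $ i\<bar>) ` cube 0 1 \<noteq> {}"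
      using cube_nonempty[of 1 0] by simp
    show "t \<le> 1" if t: "t \<in> (\<lambda>y :: real ^ 'n. \<bar>1 / 2 + e * y $ i\<bar>) ` cube 0 1" for t
    proof -
      obtain y :: "real ^ 'n" where y: "t = \<bar>1 / 2 + e * y $ i\<bar>" "y \<in> cube 0 1"
        using t by blast
      then have "- (1 / 2) \<le> y $ i" "y $ i < 1 / 2"
        by (simp_all add: cube_def)
      then show ?thesis
        using y(1) assms(3) by auto
    qed
    show "1 \<le> t" if t: "\<And>r. r \<in> (\<lambda>y :: real ^ 'n. \<bar>1 / 2 + e * y $ i\<bar>) ` cube 0 1 \<Longrightarrow> r \<le> t" for t
    \<comment> \<open>For \<open>e = 1\<close> the supremum is not attained on the half-open cube,
      so every value \<open>w\<close> in \<open>(0, 1)\<close> is realized instead;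
      \<open>e * e = 1\<close> makes the point below do this for both signs.\<close>
    proof (rule dense_le_bounded[of 0])
      fix w :: real assume w: "0 < w" "w < 1"
      define y :: "real ^ 'n" where "y = (\<chi> j. e * (w - 1 / 2))"
      have "y \<in> cube 0 1" "\<bar>1 / 2 + e * y $ i\<bar> = w"
        using w assms(3) by (auto simp: y_def cube_def)
      then show "w \<le> t"
        using t by (metis imageI)
    qed simp
  qed
  ultimately show ?thesis
    using polynomial_deg_less_affine[OF assms(1), of "1 / 2" e i]
    unfolding cube_normalized_polynomial_def normalized_polynomial_def eq by simp
qed

section \<open>Cutting layers off cubes and boxes\<close>

locale cube_norming_measure =
  fixes \<mu> :: "(real ^ 'n) measure" and \<kappa> :: nat and C :: real
  assumes sets_eq [measurable_cong, simp]: "sets \<mu> = sets borel"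
    and locally_finite: "locally_finite_measure \<mu>"
    and degree: "\<kappa> > 1"
    and C_pos: "C > 0"
    and norming: "\<And>c l P. \<lbrakk> l > 0; cube_normalized_polynomial c l \<kappa> P \<rbrakk> \<Longrightarrow>
           emeasure \<mu> (cube c l) \<le> ennreal C * (\<integral>\<^sup>+ x\<in>cube c l. ennreal (\<bar>P x\<bar>\<^sup>2) \<partial>\<mu>)"
begin

text \<open>Finiteness allows a multiple of the measure of a cube to be absorbed into the other side
  of an inequality.\<close>

lemma emeasure_cube_finite: "emeasure \<mu> (cube c l) < \<infinity>"
proof -
  let ?K = "cbox (\<chi> i. c $ i - l / 2) (\<chi> i. c $ i + l / 2)"
  have "emeasure \<mu> (cube c l) \<le> emeasure \<mu> ?K"
    by (intro emeasure_mono) (auto simp: cube_def mem_box_cart less_imp_le)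
  also have "\<dots> < \<infinity>"
    by (intro locally_finite_measure_compact[OF locally_finite] compact_cbox) simp
  finally show ?thesis .
qed

text \<open>The sign \<open>e\<close> selects the lower or the upper face in direction \<open>i\<close>.\<close>

lemma emeasure_cube_cut_layer:
  assumes s: "0 < s" and e: "e = 1 \<or> e = -1" and d: "0 < d" "C * d\<^sup>2 \<le> 1 / 2"
  shows "emeasure \<mu> (cube c s) \<le>
    ennreal (2 * C) * emeasure \<mu> {x \<in> cube c s. - s / 2 + d * s < e * (x $ i - c $ i)}"
proof -
  define K where "K = cube c s"
  \<comment> \<open>With \<open>P\<close> as below, \<open>G\<close> is the part of \<open>K\<close>
    where \<open>P\<close> exceeds \<open>d\<close>, and \<open>K - G\<close> is the layer along the
    face on which \<open>P\<close> vanishes.\<close>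
  define G where "G = {x \<in> K. - s / 2 + d * s < e * (x $ i - c $ i)}"
  define P where "P x = 1 / 2 + e * (x $ i - c $ i) / s" for x :: "real ^ 'n"
  have K [measurable]: "K \<in> sets borel"
    by (simp add: K_def)
  have "open {x :: real ^ 'n. - s / 2 + d * s < e * (x $ i - c $ i)}"
    by (intro open_Collect_less continuous_intros)
  moreover have "G = K \<inter> {x. - s / 2 + d * s < e * (x $ i - c $ i)}"
    by (auto simp: G_def)
  ultimately have G [measurable]: "G \<in> sets borel"
    using K by (simp add: sets.Int)
  have P_range: "0 \<le> P x" "P x \<le> 1" if "x \<in> K" for x
  proof -
    have "c $ i - s / 2 \<le> x $ i" "x $ i < c $ i + s / 2"
      using that by (simp_all add: K_def cube_def)
    then show "0 \<le> P x" "P x \<le> 1"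
      using e s by (auto simp: P_def field_simps)
  qed
  have P_layer: "P x \<le> d" if "x \<in> K - G" for x
    using that s by (auto simp: P_def G_def field_simps)
  have "emeasure \<mu> K \<le> ennreal C * (\<integral>\<^sup>+ x\<in>K. ennreal (\<bar>P x\<bar>\<^sup>2) \<partial>\<mu>)"
    unfolding K_def P_def by (intro norming cube_normalized_polynomial_affine s e degree)
  \<comment> \<open>The square of \<open>P\<close> is at most \<open>d^2\<close> on the layer and at
    most 1 on \<open>G\<close>; keeping the term \<open>d^2\<close> on all of \<open>K\<close>
    prepares the absorption.\<close>
  also have "(\<integral>\<^sup>+ x\<in>K. ennreal (\<bar>P x\<bar>\<^sup>2) \<partial>\<mu>) \<le>
      (\<integral>\<^sup>+ x. ennreal (d\<^sup>2) * indicator K x + indicator G x \<partial>\<mu>)"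
  proof (rule nn_integral_mono)
    fix x
    consider "x \<notin> K" | "x \<in> G" | "x \<in> K - G"
      by blast
    then show "ennreal (\<bar>P x\<bar>\<^sup>2) * indicator K x \<le> ennreal (d\<^sup>2) * indicator K x + indicator G x"
    proof cases
      case 2
      then have "x \<in> K"
        by (simp add: G_def)
      then have "(P x)\<^sup>2 \<le> 1"
        using P_range[of x] by (simp add: power_le_one)
      then have "ennreal ((P x)\<^sup>2) \<le> 1"
        by (simp add: ennreal_le_1)
      then show ?thesis
        using 2 \<open>x \<in> K\<close> by (simp add: add_increasing)
    next
      case 3
      then have "(P x)\<^sup>2 \<le> d\<^sup>2"
        using P_range[of x] P_layer[of x] by (simp add: power_mono)
      then show ?thesis
        using 3 by (simp add: ennreal_leI)
    qed simp
  qed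
  also have "\<dots> = ennreal (d\<^sup>2) * emeasure \<mu> K + emeasure \<mu> G"
    by (subst nn_integral_add) (simp_all add: nn_integral_cmult_indicator)
  finally have le: "emeasure \<mu> K \<le> ennreal C * (ennreal (d\<^sup>2) * emeasure \<mu> K + emeasure \<mu> G)"
    by (simp add: mult_left_mono)
  have K_fin: "emeasure \<mu> K < \<infinity>"
    unfolding K_def by (rule emeasure_cube_finite)
  have "emeasure \<mu> G \<le> emeasure \<mu> K"
    by (intro emeasure_mono) (auto simp: G_def)
  then have fin: "emeasure \<mu> K = ennreal (measure \<mu> K)" "emeasure \<mu> G = ennreal (measure \<mu> G)"
    using K_fin by (auto intro!: emeasure_eq_ennreal_measure)
  have "measure \<mu> K \<le> C * (d\<^sup>2 * measure \<mu> K + measure \<mu> G)"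
    using le C_pos unfolding fin
    by (simp flip: ennreal_mult ennreal_plus)
  \<comment> \<open>The layer contributes at most half of the measure of \<open>K\<close>;
    subtracting this half leaves the factor \<open>2 * C\<close>.\<close>
  moreover have "C * d\<^sup>2 * measure \<mu> K \<le> 1 / 2 * measure \<mu> K"
    using d(2) by (intro mult_right_mono) auto
  ultimately have "measure \<mu> K \<le> 2 * C * measure \<mu> G"
    by (simp add: algebra_simps)
  then show ?thesis
    using C_pos unfolding K_def[symmetric] G_def[symmetric] fin
    by (simp flip: ennreal_mult)
qed

text \<open>Each corner cube of side \<open>s\<close>, after losing its own layer, lies in
  \<open>B\<close>, so the bound for cubes applies to each of the \<open>2^n\<close> corners. Taking
  any \<open>B\<close> that contains the rest of the box avoids deciding whether the cutting
  hyperplane belongs to it.\<close>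

lemma emeasure_box_cut_layer:
  fixes u v :: "real ^ 'n" and e :: real
  assumes s: "0 < s" and e: "e = 1 \<or> e = -1" and d: "0 < d" "C * d\<^sup>2 \<le> 1 / 2"
    and sides: "\<And>j. s \<le> v $ j - u $ j" "\<And>j. v $ j - u $ j \<le> 2 * s"
    and B: "B \<in> sets borel"
      "\<And>x. \<lbrakk> x \<in> half_open_box u v;
        if e = 1 then u $ i + d * s < x $ i else x $ i < v $ i - d * s \<rbrakk> \<Longrightarrow> x \<in> B"
  shows "emeasure \<mu> (half_open_box u v) \<le> ennreal (2 ^ CARD('n) * (2 * C)) * emeasure \<mu> B"
proof -
  \<comment> \<open>\<open>m S\<close> is the centre of the corner cube at the lower end in the
    directions of \<open>S\<close> and at the upper end in the others.\<close>
  define m :: "'n set \<Rightarrow> real ^ 'n"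
    where "m S = (\<chi> j. if j \<in> S then u $ j + s / 2 else v $ j - s / 2)" for S
  have cover: "half_open_box u v \<subseteq> (\<Union>S. cube (m S) s)"
  proof
    fix x assume x: "x \<in> half_open_box u v"
    \<comment> \<open>In a direction outside this set, \<open>x $ j\<close> is at least
      \<open>u $ j + s\<close>, hence at least \<open>v $ j - s\<close> because the side is at most
      \<open>2 * s\<close>.\<close>
    have "x \<in> cube (m {j. x $ j < u $ j + s}) s"
      unfolding cube_def mem_Collect_eq
    proof
      fix j
      show "m {j. x $ j < u $ j + s} $ j - s / 2 \<le> x $ j \<and>
          x $ j < m {j. x $ j < u $ j + s} $ j + s / 2"
        using x sides(2)[of j] by (auto simp: m_def half_open_box_def)
    qed
    then show "x \<in> (\<Union>S. cube (m S) s)"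
      by blast
  qed
  have inside: "cube (m S) s \<subseteq> half_open_box u v" for S
  proof
    fix x assume x: "x \<in> cube (m S) s"
    show "x \<in> half_open_box u v"
      unfolding half_open_box_def mem_Collect_eq
    proof
      fix j
      have "m S $ j - s / 2 \<le> x $ j" "x $ j < m S $ j + s / 2"
        using x by (auto simp: cube_def)
      then show "u $ j \<le> x $ j \<and> x $ j < v $ j"
        using sides(1)[of j] by (auto simp: m_def split: if_splits)
    qed
  qed
  have small: "emeasure \<mu> (cube (m S) s) \<le> ennreal (2 * C) * emeasure \<mu> B" for S
  proof -
    have "x \<in> B" if x: "x \<in> cube (m S) s" "- s / 2 + d * s < e * (x $ i - m S $ i)" for x
    proof (rule B(2))
      show "x \<in> half_open_box u v"
        using inside x(1) by blast
      \<comment> \<open>If the corner cube touches the face being cut, its layer lies in that of the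
        box. If it sits at the opposite end, \<open>s \<le> v $ i - u $ i\<close> puts its remainder
        at least as far from that face.\<close>
      show "if e = 1 then u $ i + d * s < x $ i else x $ i < v $ i - d * s"
        using x(2) e sides(1)[of i] by (auto simp: m_def split: if_splits)
    qed
    then have "emeasure \<mu> {x \<in> cube (m S) s. - s / 2 + d * s < e * (x $ i - m S $ i)} \<le> emeasure \<mu> B"
      using B(1) by (intro emeasure_mono) auto
    then show ?thesis
      using emeasure_cube_cut_layer[OF s e d, of "m S" i] by (meson mult_left_mono order_trans zero_le)
  qed
  have "emeasure \<mu> (half_open_box u v) \<le> emeasure \<mu> (\<Union>S. cube (m S) s)"
    using cover by (intro emeasure_mono) auto
  also have "\<dots> \<le> (\<Sum>S\<in>UNIV. emeasure \<mu> (cube (m S) s))"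
    by (intro emeasure_subadditive_finite) auto
  also have "\<dots> \<le> (\<Sum>S\<in>(UNIV :: 'n set set). ennreal (2 * C) * emeasure \<mu> B)"
    by (intro sum_mono small)
  also have "\<dots> = ennreal (2 ^ CARD('n) * (2 * C)) * emeasure \<mu> B"
    using C_pos by (simp add: card_UNIV_set ennreal_mult mult.assoc flip: ennreal_power)
  finally show ?thesis .
qed

text \<open>Induction on the set \<open>J\<close> of directions already treated: each new direction
  costs one factor \<open>A\<close> for its lower and one for its upper face. The thickness is
  \<open>d * (l / 2)\<close> because corner cubes of side \<open>l / 2\<close> serve at every
  stage.\<close>

lemma emeasure_cube_cut_faces:
  assumes l: "0 < l" and d: "0 < d" "C * d\<^sup>2 \<le> 1 / 2" "d \<le> 1 / 2"
  defines "A \<equiv> ennreal (2 ^ CARD('n) * (2 * C))"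
  shows "emeasure \<mu> (cube c l) \<le> A ^ (2 * card J) * emeasure \<mu> (half_open_box
    (\<chi> j. c $ j - l / 2 + (if j \<in> J then d * (l / 2) else 0))
    (\<chi> j. c $ j + l / 2 - (if j \<in> J then d * (l / 2) else 0)))"
  using finite[of J]
proof (induction J rule: finite_induct)
  case empty
  show ?case
    by (simp add: cube_eq_half_open_box)
next
  case (insert i J)
  define u where "u J = (\<chi> j. c $ j - l / 2 + (if j \<in> J then d * (l / 2) else 0))" for J
  define v where "v J = (\<chi> j. c $ j + l / 2 - (if j \<in> J then d * (l / 2) else 0))" for J
  define h where "h = d * (l / 2)"
  have "d * (l / 2) \<le> 1 / 2 * (l / 2)"
    using l d by (intro mult_right_mono) auto
  then have h: "0 \<le> h" "4 * h \<le> l"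
    using l d by (simp_all add: h_def)
  \<comment> \<open>As \<open>h\<close> is at most \<open>l / 4\<close>, a side that has lost both
    layers still has length at least \<open>l / 2\<close>. Two index sets occur because the lower
    face in direction \<open>i\<close> is moved before the upper one.\<close>
  have sides: "l / 2 \<le> v J' $ j - u J $ j \<and> v J' $ j - u J $ j \<le> 2 * (l / 2)" for J J' j
    using h unfolding u_def v_def vec_lambda_beta h_def[symmetric]
    by (cases "j \<in> J"; cases "j \<in> J'"; simp)
  have "emeasure \<mu> (half_open_box (u J) (v J)) \<le> A * emeasure \<mu> (half_open_box (u (insert i J)) (v J))"
    unfolding A_def
  proof (rule emeasure_box_cut_layer[of "l / 2" 1 d _ _ _ i])
    fix x
    assume x: "x \<in> half_open_box (u J) (v J)"
      "if (1 :: real) = 1 then u J $ i + d * (l / 2) < x $ i else x $ i < v J $ i - d * (l / 2)"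
    show "x \<in> half_open_box (u (insert i J)) (v J)"
      using x insert.hyps unfolding half_open_box_def by (auto simp: u_def split: if_splits)
  qed (use l d sides in \<open>simp_all\<close>)
  also have "emeasure \<mu> (half_open_box (u (insert i J)) (v J)) \<le>
      A * emeasure \<mu> (half_open_box (u (insert i J)) (v (insert i J)))"
    unfolding A_def
  proof (rule emeasure_box_cut_layer[of "l / 2" "-1" d _ _ _ i])
    fix x
    assume x: "x \<in> half_open_box (u (insert i J)) (v J)"
      "if (-1 :: real) = 1 then u (insert i J) $ i + d * (l / 2) < x $ i
       else x $ i < v J $ i - d * (l / 2)"
    show "x \<in> half_open_box (u (insert i J)) (v (insert i J))"
      using x insert.hyps unfolding half_open_box_def by (auto simp: v_def split: if_splits)
  qed (use l d sides in \<open>simp_all\<close>)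
  finally have step: "emeasure \<mu> (half_open_box (u J) (v J)) \<le>
      A * (A * emeasure \<mu> (half_open_box (u (insert i J)) (v (insert i J))))"
    by (simp add: mult_left_mono)
  have "emeasure \<mu> (cube c l) \<le> A ^ (2 * card J) * emeasure \<mu> (half_open_box (u J) (v J))"
    using insert.IH unfolding u_def v_def .
  also have "\<dots> \<le> A ^ (2 * card J) *
      (A * (A * emeasure \<mu> (half_open_box (u (insert i J)) (v (insert i J)))))"
    by (intro mult_left_mono step) simp
  also have "\<dots> = A ^ (2 * card (insert i J)) *
      emeasure \<mu> (half_open_box (u (insert i J)) (v (insert i J)))"
    using insert.hyps by (simp add: mult_ac)
  finally show ?case
    unfolding u_def v_def .
qed

section \<open>The dilation factor and the doubling constant\<close>

lemma doubling: "doubling_measure \<mu>"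
proof -
  \<comment> \<open>This choice gives both \<open>d < 1 / 2\<close> and
    \<open>C * d \<le> 1 / 2\<close>; the bound on \<open>C * d^2\<close> follows since
    \<open>d\<close> is below 1.\<close>
  define d where "d = 1 / (2 * C + 2)"
  define A where "A = (2 ^ CARD('n) * (2 * C)) ^ (2 * CARD('n))"
  \<comment> \<open>The summand 1 ensures \<open>g < 1\<close> for every positive \<open>A\<close>,
    while \<open>g * A \<le> 1\<close> still holds.\<close>
  define g where "g = 1 / (A + 1)"
  have d: "0 < d" "d < 1 / 2" "C * d \<le> 1 / 2"
    using C_pos by (auto simp: d_def field_simps)
  have "C * d * d \<le> C * d"
    using d C_pos by (intro mult_left_le) auto
  then have d2: "C * d\<^sup>2 \<le> 1 / 2"
    using d(3) by (simp add: power2_eq_square mult.assoc)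
  have A: "0 < A"
    using C_pos by (simp add: A_def)
  then have g: "0 < g" "g < 1" "g * A \<le> 1"
    by (auto simp: g_def field_simps)
  have "ennreal g * emeasure \<mu> (cube c l) \<le> emeasure \<mu> (cube c ((1 - d) * l))"
    if l: "0 < l" for c l
  proof -
    have "emeasure \<mu> (cube c l) \<le> ennreal A * emeasure \<mu> (cube c ((1 - d) * l))"
    proof -
      \<comment> \<open>Losing \<open>d * (l / 2)\<close> at both ends in every direction keeps the
        centre and leaves the side length \<open>(1 - d) * l\<close>.\<close>
      have "half_open_box
          (\<chi> j. c $ j - l / 2 + (if j \<in> UNIV then d * (l / 2) else 0))
          (\<chi> j. c $ j + l / 2 - (if j \<in> UNIV then d * (l / 2) else 0)) = cube c ((1 - d) * l)"
        unfolding cube_eq_half_open_box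
        by (intro arg_cong2[where f = half_open_box]) (simp_all add: vec_eq_iff field_simps)
      moreover have "ennreal (2 ^ CARD('n) * (2 * C)) ^ (2 * card (UNIV :: 'n set)) = ennreal A"
        using C_pos unfolding A_def by (intro ennreal_power) simp
      ultimately show ?thesis
        using emeasure_cube_cut_faces[OF l d(1) d2, of c UNIV] d(2) by simp
    qed
    then have "ennreal g * emeasure \<mu> (cube c l) \<le>
        ennreal g * (ennreal A * emeasure \<mu> (cube c ((1 - d) * l)))"
      by (rule mult_left_mono) simp
    also have "\<dots> = ennreal (g * A) * emeasure \<mu> (cube c ((1 - d) * l))"
      using A g by (simp add: ennreal_mult mult.assoc)
    also have "\<dots> \<le> 1 * emeasure \<mu> (cube c ((1 - d) * l))"
      using g(3) by (intro mult_right_mono) (auto simp: ennreal_le_1)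
    finally show ?thesis
      by simp
  qed
  then show ?thesis
    unfolding doubling_measure_def using d g by (intro exI[of _ "1 - d"] exI[of _ g]) auto
qed

end

theorem lemma16:
  fixes \<mu> :: "(real ^ 'n) measure" and \<kappa> :: nat and C :: real
  assumes "sets \<mu> = sets borel"
    and "locally_finite_measure \<mu>"
    and "\<kappa> > 1"
    and "C > 0"
    and "\<And>c l P. \<lbrakk> l > 0; cube_normalized_polynomial c l \<kappa> P \<rbrakk> \<Longrightarrow>
           emeasure \<mu> (cube c l) \<le> ennreal C * (\<integral>\<^sup>+ x\<in>cube c l. ennreal (\<bar>P x\<bar>\<^sup>2) \<partial>\<mu>)"
  shows "doubling_measure \<mu>"
proof -
  interpret cube_norming_measure \<mu> \<kappa> C
    by unfold_locales (use assms in auto)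
  show ?thesis
    by (rule doubling)
qed

end
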